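(* For $r\le-1$, consider the positively equicorrelated Gaussian model $G_{\mu_m,\pi_m,\rho}$ where $\mu_m=\sqrt{2c\log m}$ with $c>0$. For all $\rho\in[0,1]$, if further one of the following is satisfied: (a) $\lim_{m\to\infty}\pi_m=\pi>0$ and $\sqrt c>1-\sqrt{1-\rho}$; (b) $\pi_m=m^{\gamma-1}$, where $0<\gamma<1$, and $\sqrt c>1-\sqrt{\gamma(1-\rho)}$, then for all $\alpha>0$, $$\lim_{m\to\infty}\beta_{\mu_m,\pi_m,\rho}(r,\alpha)=1.$$
   Context: $\Phi$ is the standard normal CDF. Model $G_{\mu_m,\pi_m,\rho}$ (positively equicorrelated Gaussian, $\rho\in[0,1]$): for each $m$, conditionally on means $\mu_{m1},\dots,\mu_{mm}$, the vector $(X_{m1},\dots,X_{mm})$ is Gaussian with these means, unit variances and all pairwise correlations equal to $\rho$; the means are i.i.d. with $\mu_{mi}\sim\mu_mB_m$, where $\mu_m>0$ is a scalar and $B_m$ is Bernoulli with parameter $\pi_m$. Equivalently $X_{mi}=\mu_{mi}+\sqrt\rho\,Z_0+\sqrt{1-\rho}\,Z_i$ with $Z_0,Z_1,\dots,Z_m$ i.i.d. $N(0,1)$ independent of the means. The one-sided $p$-values are $p_{mi}=\Phi(-X_{mi})$. The power is $$\beta_{\mu_m,\pi_m,\rho}(r,\alpha)=\Pr_{G_{\mu_m,\pi_m,\rho}}\Big\{\Big(\frac1m\sum_{i=1}^mp_{mi}^r\Big)^{1/r}\le c_r(m,\alpha)\Big\},$$ where the calibrated threshold (not to be confused with the signal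 constant $c$) is specified (derived in the paper as $\alpha\to0$) by $c_r(m,\alpha)=\alpha m^{\frac1{|r|}-1}$ for $r<-1$ and $c_{-1}(m,\alpha)=\dfrac{\alpha}{1+\alpha\log m}$. *)

theory Defs
  imports "HOL-Probability.Probability"
begin

definition Phi :: "real \<Rightarrow> real" where
  "Phi = cdf std_normal_distribution"

text \<open>Law of a single mean: \<open>\<mu>\<close> times a Bernoulli variable with parameter \<open>p\<close>
  (meaningful for \<open>0 \<le> p \<le> 1\<close>).\<close>

definition mean_law :: "real \<Rightarrow> real \<Rightarrow> real measure" where
  "mean_law \<mu> p = distr (measure_pmf (bernoulli_pmf p)) borel (\<lambda>b. \<mu> * of_bool b)"

text \<open>Joint law of \<open>(X\<^sub>1, \<dots>, X\<^sub>m)\<close>. The components of \<open>\<theta>\<close> are the i.i.d. means and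
  those of \<open>z\<close> are i.i.d. standard normal and independent of the means; \<open>z 0\<close> is the factor
  shared by all observations. Given the means, the vector is Gaussian with these means,
  unit variances and all pairwise correlations equal to \<open>\<rho>\<close>, for \<open>0 \<le> \<rho> \<le> 1\<close>.\<close>

definition equicorr_gauss :: "nat \<Rightarrow> real \<Rightarrow> real \<Rightarrow> real \<Rightarrow> (nat \<Rightarrow> real) measure" where
  "equicorr_gauss m \<mu> p \<rho> =
     distr ((\<Pi>\<^sub>M i\<in>{1..m}. mean_law \<mu> p) \<Otimes>\<^sub>M (\<Pi>\<^sub>M i\<in>{0..m}. std_normal_distribution))
       (\<Pi>\<^sub>M i\<in>{1..m}. borel)
       (\<lambda>(\<theta>, z). \<lambda>i\<in>{1..m}. \<theta> i + sqrt \<rho> * z 0 + sqrt (1 - \<rho>) * z i)"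

definition p_value :: "real \<Rightarrow> real" where
  "p_value x = Phi (- x)"

definition combined_p :: "real \<Rightarrow> nat \<Rightarrow> (nat \<Rightarrow> real) \<Rightarrow> real" where
  "combined_p r m X = ((1 / real m) * (\<Sum>i=1..m. p_value (X i) powr r)) powr (1 / r)"

text \<open>Calibrated threshold; only meant for \<open>r \<le> -1\<close>.\<close>

definition threshold :: "real \<Rightarrow> nat \<Rightarrow> real \<Rightarrow> real" where
  "threshold r m \<alpha> =
     (if r = -1 then \<alpha> / (1 + \<alpha> * ln (real m))
      else \<alpha> * real m powr (1 / \<bar>r\<bar> - 1))"

definition power_of_test ::
  "nat \<Rightarrow> real \<Rightarrow> real \<Rightarrow> real \<Rightarrow> real \<Rightarrow> real \<Rightarrow> real" where
  "power_of_test m \<mu> p \<rho> r \<alpha> =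
     measure (equicorr_gauss m \<mu> p \<rho>)
       {X \<in> space (equicorr_gauss m \<mu> p \<rho>). combined_p r m X \<le> threshold r m \<alpha>}"

text \<open>The map defining the model is measurable and the rejection region is an event, so
  none of the measures above degenerates to a default value.\<close>

lemma sets_mean_law [measurable_cong, simp]: "sets (mean_law \<mu> p) = sets borel"
  by (simp add: mean_law_def)

lemma prob_space_mean_law: "prob_space (mean_law \<mu> p)"
  unfolding mean_law_def by (rule measure_pmf.prob_space_distr) simp

lemma equicorr_gauss_measurable:
  fixes m :: nat
  shows "(\<lambda>(\<theta>, z). \<lambda>i\<in>{1..m}. \<theta> i + sqrt \<rho> * z 0 + sqrt (1 - \<rho>) * z i)
     \<in> (\<Pi>\<^sub>M i\<in>{1..m}. mean_law \<mu> p) \<Otimes>\<^sub>M (\<Pi>\<^sub>M i\<in>{0..m}. std_normal_distribution)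
       \<rightarrow>\<^sub>M (\<Pi>\<^sub>M i\<in>{1..m}. borel)"
proof -
  have 1: "(\<lambda>w. fst w i) \<in> borel_measurable
      ((\<Pi>\<^sub>M i\<in>{1..m}. mean_law \<mu> p) \<Otimes>\<^sub>M (\<Pi>\<^sub>M i\<in>{0..m}. std_normal_distribution))"
    if "i \<in> {1..m}" for i
    using measurable_compose[OF measurable_fst
        measurable_component_singleton[OF that, of "\<lambda>_. mean_law \<mu> p"]]
    by (simp add: measurable_cong_sets[OF refl sets_mean_law])
  have 2: "(\<lambda>w. snd w i) \<in> borel_measurable
      ((\<Pi>\<^sub>M i\<in>{1..m}. mean_law \<mu> p) \<Otimes>\<^sub>M (\<Pi>\<^sub>M i\<in>{0..m}. std_normal_distribution))"
    if "i \<in> {0..m}" for i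
    using measurable_compose[OF measurable_snd
        measurable_component_singleton[OF that, of "\<lambda>_. std_normal_distribution"]]
    by simp
  show ?thesis
    unfolding case_prod_beta
    by (intro measurable_restrict borel_measurable_add borel_measurable_times
        borel_measurable_const 1 2) auto
qed

lemma prob_space_equicorr_gauss: "prob_space (equicorr_gauss m \<mu> p \<rho>)"
proof -
  interpret A: prob_space "\<Pi>\<^sub>M i\<in>{1..m}. mean_law \<mu> p"
    by (intro prob_space_PiM prob_space_mean_law)
  interpret B: prob_space "\<Pi>\<^sub>M i\<in>{0..m}. std_normal_distribution"
    by (intro prob_space_PiM prob_space_normal_density) simp
  interpret pair_prob_space "\<Pi>\<^sub>M i\<in>{1..m}. mean_law \<mu> p"
    "\<Pi>\<^sub>M i\<in>{0..m}. std_normal_distribution" ..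
  show ?thesis
    unfolding equicorr_gauss_def by (rule prob_space_distr) (rule equicorr_gauss_measurable)
qed

lemma p_value_measurable [measurable]: "p_value \<in> borel_measurable borel"
proof -
  interpret real_distribution std_normal_distribution
    by (rule real_dist_normal_dist)
  have [measurable]: "Phi \<in> borel_measurable borel"
    unfolding Phi_def by (intro borel_measurable_mono monoI cdf_nondecreasing)
  show ?thesis
    unfolding p_value_def [abs_def] by measurable
qed

lemma rejection_event:
  "{X \<in> space (equicorr_gauss m \<mu> p \<rho>). combined_p r m X \<le> threshold r m \<alpha>}
     \<in> sets (equicorr_gauss m \<mu> p \<rho>)"
proof -
  have [measurable_cong]: "sets (equicorr_gauss m \<mu> p \<rho>) = sets (\<Pi>\<^sub>M i\<in>{1..m}. borel)"
    by (simp add: equicorr_gauss_def)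
  show ?thesis
    unfolding combined_p_def by measurable
qed

end

theory Submission
  imports Defs "HOL-Real_Asymp.Real_Asymp"
begin

text \<open>
  A single sufficiently small p-value already forces rejection. For negative \<open>r\<close> the power mean
  is at most \<open>m powr (1 / \<bar>r\<bar>)\<close> times each p-value, so that one p-value below
  \<open>\<alpha> / (m (1 + \<alpha> ln m))\<close> suffices for both forms of the threshold
  (\<open>combined_p_le_threshold\<close>). Write \<open>l = sqrt (2 ln m)\<close>. By Chernoff's bound an observation
  \<open>X\<^sub>j \<ge> s l\<close> has p-value at most \<open>m powr (- s\<^sup>2)\<close>, which is eventually small enough
  as soon as \<open>s > 1\<close>. Everything therefore comes down to one observation exceeding \<open>s l\<close> for some
  fixed \<open>s > 1\<close>.

  In both regimes of the theorem the signal probability is eventually at least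
  \<open>\<kappa> * m powr (\<gamma> - 1)\<close> for some \<open>\<kappa> > 0\<close>, with \<open>\<gamma> = 1\<close> in the dense regime. There are thus at
  least of the order of \<open>m powr \<gamma>\<close> signals, all of height \<open>sqrt c * l\<close>, and the largest of their idiosyncratic noises
  exceeds \<open>t l\<close> with probability tending to one for every \<open>t < sqrt \<gamma>\<close>. Quantitatively, a given
  coordinate is a signal with noise at least \<open>x\<close> with probability \<open>p q\<close>, where \<open>q\<close> is the normal
  tail at \<open>x\<close>; by independence no coordinate is one with probability \<open>(1 - p q)\<^sup>m\<close>
  (\<open>emeasure_no_large_signal\<close>), at most \<open>exp (- m p q)\<close>; and \<open>m p q\<close> tends to infinity at
  \<open>x = t l\<close> (\<open>expected_large_signals_at_top\<close>). The shared factor \<open>Z\<^sub>0\<close>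
  is bounded in probability, hence above \<open>- e l\<close> with probability tending to one for every \<open>e > 0\<close>.
  So the best observation reaches \<open>(sqrt c + sqrt (1 - \<rho>) t - sqrt \<rho> e) l\<close>. The condition on
  \<open>c\<close> is precisely \<open>sqrt c + sqrt (1 - \<rho>) sqrt \<gamma> > 1\<close>, which leaves room for \<open>t\<close> below
  \<open>sqrt \<gamma>\<close>, for \<open>e > 0\<close> and for \<open>s > 1\<close>.
\<close>

section \<open>Tail bounds for the standard normal distribution\<close>

lemma emeasure_std_normal:
  assumes "A \<in> sets borel"
  shows "emeasure std_normal_distribution A
    = (\<integral>\<^sup>+ t. ennreal (std_normal_density t) * indicator A t \<partial>lborel)"
  using assms by (subst emeasure_density) auto

text \<open>Shifting the tail to the negative half-line turns the density \<open>\<phi>(u - x)\<close> into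
  \<open>exp (- x\<^sup>2 / 2) \<phi>(u) exp (u x)\<close>, whose last factor is at most one for \<open>u \<le> 0 \<le> x\<close>.\<close>

lemma std_normal_lower_tail_le:
  assumes "x \<ge> 0"
  shows "measure std_normal_distribution {..-x} \<le> exp (- x\<^sup>2 / 2)"
proof -
  interpret prob_space std_normal_distribution by (rule prob_space_normal_density) simp
  have "emeasure std_normal_distribution {..-x}
      = (\<integral>\<^sup>+ u. ennreal (std_normal_density (u - x)) * indicator {..-x} (u - x) \<partial>lborel)"
    by (subst emeasure_std_normal, simp, subst nn_integral_real_affine[where c = 1 and t = "-x"]) auto
  also have "\<dots> \<le> (\<integral>\<^sup>+ u. ennreal (exp (- x\<^sup>2 / 2)) * ennreal (std_normal_density u) \<partial>lborel)"
  proof (rule nn_integral_mono)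
    fix u :: real
    show "ennreal (std_normal_density (u - x)) * indicator {..-x} (u - x)
        \<le> ennreal (exp (- x\<^sup>2 / 2)) * ennreal (std_normal_density u)"
    proof (cases "u \<le> 0")
      case True
      have "- (u - x)\<^sup>2 / 2 = - x\<^sup>2 / 2 + (- u\<^sup>2 / 2 + u * x)"
        by (simp add: power2_eq_square field_simps)
      moreover have "u * x \<le> 0"
        using True assms by (simp add: mult_nonpos_nonneg)
      ultimately have "exp (- (u - x)\<^sup>2 / 2) \<le> exp (- x\<^sup>2 / 2) * exp (- u\<^sup>2 / 2)"
        unfolding exp_add[symmetric] by simp
      then have "std_normal_density (u - x) \<le> exp (- x\<^sup>2 / 2) * std_normal_density u"
        unfolding std_normal_density_def by (simp add: field_simps)
      then show ?thesis
        by (auto simp: indicator_def ennreal_mult[symmetric] intro!: ennreal_leI)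
    qed (simp add: indicator_def)
  qed
  also have "\<dots> = ennreal (exp (- x\<^sup>2 / 2)) * emeasure std_normal_distribution UNIV"
    by (subst nn_integral_cmult) (auto simp: emeasure_std_normal)
  also have "\<dots> = ennreal (exp (- x\<^sup>2 / 2))"
    using emeasure_space_1 by simp
  finally show ?thesis
    by (simp add: emeasure_eq_measure)
qed

text \<open>Crude, but it loses only a factor \<open>exp (- O(\<bar>a\<bar>))\<close>. For \<open>a\<close> of order \<open>sqrt (ln m)\<close> this is
  negligible against every power of \<open>m\<close>, so the optimal constant in the detection boundary
  survives.\<close>

lemma std_normal_unit_interval_ge:
  "std_normal_density (\<bar>a\<bar> + 1) \<le> measure std_normal_distribution {a..a + 1}"
proof -
  interpret prob_space std_normal_distribution by (rule prob_space_normal_density) simp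
  have "ennreal (std_normal_density (\<bar>a\<bar> + 1))
      = (\<integral>\<^sup>+ t. ennreal (std_normal_density (\<bar>a\<bar> + 1)) * indicator {a..a + 1} t \<partial>lborel)"
    by (subst nn_integral_cmult_indicator) auto
  also have "\<dots> \<le> emeasure std_normal_distribution {a..a + 1}"
  proof (subst emeasure_std_normal, simp, rule nn_integral_mono)
    fix t :: real
    show "ennreal (std_normal_density (\<bar>a\<bar> + 1)) * indicator {a..a + 1} t
        \<le> ennreal (std_normal_density t) * indicator {a..a + 1} t"
    proof (cases "t \<in> {a..a + 1}")
      case True
      then have "\<bar>t\<bar> \<le> \<bar>a\<bar> + 1" by auto
      then have "t\<^sup>2 \<le> (\<bar>a\<bar> + 1)\<^sup>2"
        by (metis abs_ge_zero abs_le_square_iff abs_of_nonneg add_nonneg_nonneg zero_le_one)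
      then have "std_normal_density (\<bar>a\<bar> + 1) \<le> std_normal_density t"
        unfolding std_normal_density_def by (intro mult_left_mono) auto
      then show ?thesis using True by (simp add: ennreal_leI)
    qed simp
  qed
  finally show ?thesis
    by (simp add: emeasure_eq_measure)
qed

section \<open>One small p-value forces rejection\<close>

lemma p_value_eq_measure: "p_value x = measure std_normal_distribution {..-x}"
  by (simp add: p_value_def Phi_def cdf_def)

text \<open>Since \<open>0 powr r = 0\<close> by convention, also for negative \<open>r\<close>, a vanishing p-value would
  contribute nothing to the power mean instead of dominating it.\<close>

lemma p_value_pos: "0 < p_value x"
proof -
  interpret prob_space std_normal_distribution by (rule prob_space_normal_density) simp
  have "0 < std_normal_density (\<bar>- x - 1\<bar> + 1)"
    by (simp add: normal_density_pos)
  also have "\<dots> \<le> measure std_normal_distribution {- x - 1..- x - 1 + 1}"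
    by (rule std_normal_unit_interval_ge)
  also have "\<dots> \<le> p_value x"
    unfolding p_value_eq_measure by (rule finite_measure_mono) auto
  finally show ?thesis .
qed

text \<open>The sum is bounded below by its \<open>j\<close>-th term, and the outer power \<open>1 / r\<close> is decreasing.\<close>

lemma combined_p_le:
  assumes "r < 0" "j \<in> {1..m}"
  shows "combined_p r m X \<le> real m powr (1 / \<bar>r\<bar>) * p_value (X j)"
proof -
  define p where "p = p_value (X j)"
  have p: "p > 0" unfolding p_def by (rule p_value_pos)
  have m: "real m > 0" using assms(2) by auto
  have "p powr r \<le> (\<Sum>i=1..m. p_value (X i) powr r)"
    unfolding p_def by (rule member_le_sum) (use assms(2) in auto)
  then have "1 / real m * p powr r \<le> 1 / real m * (\<Sum>i=1..m. p_value (X i) powr r)"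
    by (intro mult_left_mono) auto
  then have "combined_p r m X \<le> (1 / real m * p powr r) powr (1 / r)"
    unfolding combined_p_def using assms(1) p m by (intro powr_mono2') auto
  also have "\<dots> = (1 / real m) powr (1 / r) * p"
    using p m assms(1) by (subst powr_mult) (auto simp: powr_powr)
  also have "(1 / real m) powr (1 / r) = real m powr (1 / \<bar>r\<bar>)"
    using assms(1) m by (simp add: powr_divide powr_minus_divide)
  finally show ?thesis by (simp add: p_def)
qed

text \<open>One bound serves both thresholds: the power mean is below \<open>m powr (1 / \<bar>r\<bar>)\<close> times the p-value,
  which calls for a p-value of \<open>\<alpha> / (m (1 + \<alpha> ln m))\<close> if \<open>r = -1\<close> and of \<open>\<alpha> / m\<close> if
  \<open>r < -1\<close>. The smaller of the two costs only a logarithm.\<close>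

lemma combined_p_le_threshold:
  assumes "r \<le> -1" "\<alpha> > 0" "j \<in> {1..m}"
    and small: "p_value (X j) \<le> \<alpha> / (real m * (1 + \<alpha> * ln (real m)))"
  shows "combined_p r m X \<le> threshold r m \<alpha>"
proof -
  have m: "real m \<ge> 1" using assms(3) by auto
  have le: "combined_p r m X \<le> real m powr (1 / \<bar>r\<bar>) * p_value (X j)"
    using assms by (intro combined_p_le) auto
  have log: "1 + \<alpha> * ln (real m) \<ge> 1" using m assms(2) by simp
  show ?thesis
  proof (cases "r = -1")
    case True
    have "real m * p_value (X j) \<le> real m * (\<alpha> / (real m * (1 + \<alpha> * ln (real m))))"
      using m by (intro mult_left_mono small) auto
    also have "\<dots> = \<alpha> / (1 + \<alpha> * ln (real m))"
      using m by simp
    finally show ?thesis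
      using le m by (simp add: True threshold_def)
  next
    case False
    have "real m * 1 \<le> real m * (1 + \<alpha> * ln (real m))"
      using m by (intro mult_left_mono log) auto
    then have "\<alpha> / (real m * (1 + \<alpha> * ln (real m))) \<le> \<alpha> / real m"
      using m log assms(2) by (intro divide_left_mono mult_pos_pos less_le_trans[OF zero_less_one log]) auto
    then have "real m powr (1 / \<bar>r\<bar>) * p_value (X j) \<le> real m powr (1 / \<bar>r\<bar>) * (\<alpha> / real m)"
      using small by (intro mult_left_mono) auto
    also have "\<dots> = \<alpha> * real m powr (1 / \<bar>r\<bar> - 1)"
      using m by (simp add: powr_diff)
    finally show ?thesis
      using le by (simp add: False threshold_def)
  qed
qed

section \<open>Existence of a large signal\<close>

text \<open>Joint law of the means and of the noises, of which the observations are a function. The events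
  below are not expressible through the observations alone.\<close>

abbreviation latent :: "nat \<Rightarrow> real \<Rightarrow> real \<Rightarrow> ((nat \<Rightarrow> real) \<times> (nat \<Rightarrow> real)) measure" where
  "latent m \<mu> p \<equiv>
     (\<Pi>\<^sub>M i\<in>{1..m}. mean_law \<mu> p) \<Otimes>\<^sub>M (\<Pi>\<^sub>M i\<in>{0..m}. std_normal_distribution)"

lemma prob_space_std_normal: "prob_space std_normal_distribution"
  by (rule prob_space_normal_density) simp

lemma prob_space_latent: "prob_space (latent m \<mu> p)"
  by (intro prob_space_pair prob_space_PiM prob_space_mean_law prob_space_std_normal)

lemma nn_integral_mean_law:
  assumes "0 \<le> p" "p \<le> 1" "f \<in> borel_measurable borel"
  shows "(\<integral>\<^sup>+ t. f t \<partial>mean_law \<mu> p) = ennreal p * f \<mu> + ennreal (1 - p) * f 0"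
  using assms unfolding mean_law_def
  by (subst nn_integral_distr) (auto simp: ac_simps)

text \<open>Given the means, the event is a box for the noises, of probability \<open>1 - q\<close> per signal and
  \<open>1\<close> per null coordinate. Integrating this product over the independent means gives the power of
  \<open>p (1 - q) + (1 - p)\<close>.\<close>

lemma emeasure_no_large_signal:
  fixes m :: nat and p \<mu> x q :: real
  assumes "0 \<le> p" "p \<le> 1" "\<mu> > 0"
  defines "q \<equiv> measure std_normal_distribution {x..}"
  shows "emeasure (latent m \<mu> p)
      {w \<in> space (latent m \<mu> p). \<forall>i\<in>{1..m}. \<not> (fst w i \<ge> \<mu> \<and> snd w i \<ge> x)}
    = ennreal ((1 - p * q) ^ m)"
proof -
  note One_nat_def [simp del]
  interpret N: prob_space std_normal_distribution by (rule prob_space_std_normal)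
  interpret P: product_prob_space "\<lambda>_::nat. std_normal_distribution"
    by unfold_locales
  interpret B: prob_space "mean_law \<mu> p" by (rule prob_space_mean_law)
  interpret Q: product_prob_space "\<lambda>_::nat. mean_law \<mu> p"
    by unfold_locales
  interpret PZ: prob_space "\<Pi>\<^sub>M i\<in>{0..m}. std_normal_distribution"
    by (intro prob_space_PiM prob_space_std_normal)
  have q: "0 \<le> q" "q \<le> 1" unfolding q_def by auto
  define E where "E = {w \<in> space (latent m \<mu> p). \<forall>i\<in>{1..m}. \<not> (fst w i \<ge> \<mu> \<and> snd w i \<ge> x)}"
  have meas: "E \<in> sets (latent m \<mu> p)"
    unfolding E_def by measurable
  define f where "f t = ennreal (if t \<ge> \<mu> then 1 - q else 1)" for t
  have f[measurable]: "f \<in> borel_measurable borel"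
    unfolding f_def by measurable
  have slice: "emeasure (\<Pi>\<^sub>M i\<in>{0..m}. std_normal_distribution) (Pair \<theta> -` E)
      = (\<Prod>i\<in>{1..m}. f (\<theta> i))" if \<theta>: "\<theta> \<in> space (\<Pi>\<^sub>M i\<in>{1..m}. mean_law \<mu> p)" for \<theta>
  proof -
    \<comment> \<open>Index \<open>0\<close> belongs to the shared factor, on which the event imposes nothing.\<close>
    define B where "B i = (if i \<noteq> 0 \<and> \<theta> i \<ge> \<mu> then {..<x} else UNIV)" for i :: nat
    have indices: "{0..m} = insert 0 {1..m}" by auto
    have "Pair \<theta> -` E = (\<Pi>\<^sub>E i\<in>{0..m}. B i)"
    proof (rule set_eqI)
      fix z
      have "z \<in> Pair \<theta> -` E \<longleftrightarrow> z \<in> extensional {0..m} \<and> (\<forall>i\<in>{1..m}. \<not> (\<theta> i \<ge> \<mu> \<and> z i \<ge> x))"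
        using \<theta> by (auto simp: E_def space_pair_measure space_PiM PiE_def)
      also have "(\<forall>i\<in>{1..m}. \<not> (\<theta> i \<ge> \<mu> \<and> z i \<ge> x)) \<longleftrightarrow> (\<forall>i\<in>{1..m}. z i \<in> B i)"
        by (rule ball_cong) (auto simp: B_def)
      also have "\<dots> \<longleftrightarrow> (\<forall>i\<in>{0..m}. z i \<in> B i)"
        unfolding indices by (simp add: B_def)
      finally show "z \<in> Pair \<theta> -` E \<longleftrightarrow> z \<in> (\<Pi>\<^sub>E i\<in>{0..m}. B i)"
        by (simp add: PiE_iff conj_commute)
    qed
    then have "emeasure (\<Pi>\<^sub>M i\<in>{0..m}. std_normal_distribution) (Pair \<theta> -` E)
        = (\<Prod>i\<in>{0..m}. emeasure std_normal_distribution (B i))"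
      by (simp add: P.emeasure_PiM B_def)
    also have "\<dots> = (\<Prod>i\<in>{1..m}. emeasure std_normal_distribution (B i))"
    proof -
      have "emeasure std_normal_distribution (B 0) = 1"
        using N.emeasure_space_1 by (simp add: B_def)
      then show ?thesis unfolding indices by simp
    qed
    also have "\<dots> = (\<Prod>i\<in>{1..m}. f (\<theta> i))"
    proof (rule prod.cong)
      fix i assume "i \<in> {1..m}"
      have "UNIV - {x..} = {..<x}" by auto
      then have "measure std_normal_distribution {..<x} = 1 - q"
        unfolding q_def using N.prob_compl[of "{x..}"] by simp
      then show "emeasure std_normal_distribution (B i) = f (\<theta> i)"
        using \<open>i \<in> {1..m}\<close> N.emeasure_space_1
        by (auto simp: B_def f_def N.emeasure_eq_measure)
    qed simp
    finally show ?thesis .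
  qed
  have "emeasure (latent m \<mu> p) E
      = (\<integral>\<^sup>+ \<theta>. emeasure (\<Pi>\<^sub>M i\<in>{0..m}. std_normal_distribution) (Pair \<theta> -` E)
           \<partial>(\<Pi>\<^sub>M i\<in>{1..m}. mean_law \<mu> p))"
    by (rule PZ.emeasure_pair_measure_alt[OF meas])
  also have "\<dots> = (\<integral>\<^sup>+ \<theta>. (\<Prod>i\<in>{1..m}. f (\<theta> i)) \<partial>(\<Pi>\<^sub>M i\<in>{1..m}. mean_law \<mu> p))"
    by (rule nn_integral_cong) (rule slice)
  also have "\<dots> = (\<Prod>i\<in>{1..m}. \<integral>\<^sup>+ t. f t \<partial>mean_law \<mu> p)"
    by (rule Q.product_nn_integral_prod) auto
  also have "(\<integral>\<^sup>+ t. f t \<partial>mean_law \<mu> p) = ennreal p * f \<mu> + ennreal (1 - p) * f 0"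
    using assms by (intro nn_integral_mean_law f)
  also have "\<dots> = ennreal (1 - p * q)"
  proof -
    have eq: "p * (1 - q) + (1 - p) = 1 - p * q" by (simp add: algebra_simps)
    show ?thesis
      using assms(1-3) q by (simp add: f_def eq ennreal_mult[symmetric] flip: ennreal_plus)
  qed
  also have "(\<Prod>i\<in>{1..m}. ennreal (1 - p * q)) = ennreal ((1 - p * q) ^ m)"
    using mult_le_one[OF assms(2) q] by (simp add: ennreal_power)
  finally show ?thesis unfolding E_def .
qed

lemma prob_common_factor:
  assumes A: "A \<in> sets borel"
  shows "measure (latent m \<mu> p) {w \<in> space (latent m \<mu> p). snd w 0 \<in> A}
    = measure std_normal_distribution A"
proof -
  note One_nat_def [simp del]
  let ?Th = "\<Pi>\<^sub>M i\<in>{1..m}. mean_law \<mu> p"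
  let ?Z = "\<Pi>\<^sub>M i\<in>{0..m}. std_normal_distribution"
  interpret Th: prob_space ?Th
    by (intro prob_space_PiM prob_space_mean_law)
  interpret Z: prob_space ?Z
    by (intro prob_space_PiM prob_space_std_normal)
  define C where "C = {z \<in> space ?Z. z 0 \<in> A}"
  have C: "C \<in> sets ?Z"
    unfolding C_def using A by measurable
  have "{w \<in> space (latent m \<mu> p). snd w 0 \<in> A} = space ?Th \<times> C"
    by (auto simp: C_def space_pair_measure)
  then have "measure (latent m \<mu> p) {w \<in> space (latent m \<mu> p). snd w 0 \<in> A} = measure ?Z C"
    using Z.emeasure_pair_measure_Times[OF sets.top C, of ?Th]
    by (simp add: measure_def Th.emeasure_space_1)
  also have "\<dots> = measure (distr ?Z std_normal_distribution (\<lambda>z. z 0)) A"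
    using A by (subst measure_distr) (auto simp: C_def intro!: arg_cong[where f = "measure _"])
  also have "distr ?Z std_normal_distribution (\<lambda>z. z 0) = std_normal_distribution"
    by (rule distr_PiM_component) (auto intro: prob_space_std_normal)
  finally show ?thesis .
qed

section \<open>A lower bound on the power for fixed sample size\<close>

text \<open>Acceptance requires that no coordinate is a signal with noise at least \<open>x\<close>, or that the shared
  factor is at most \<open>- y\<close>: otherwise some observation is at least \<open>s\<close>, and its p-value is small
  enough by itself. The two subtracted terms bound the probabilities of these two events.\<close>

lemma power_of_test_ge:
  assumes "r \<le> -1" "\<alpha> > 0" "0 \<le> p" "p \<le> 1" "\<mu> > 0" "0 \<le> \<rho>" "\<rho> \<le> 1" "y \<ge> 0"
    and shift: "s \<le> \<mu> + sqrt (1 - \<rho>) * x - sqrt \<rho> * y" and "s \<ge> 0"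
    and small: "exp (- s\<^sup>2 / 2) \<le> \<alpha> / (real m * (1 + \<alpha> * ln (real m)))"
  shows "power_of_test m \<mu> p \<rho> r \<alpha>
    \<ge> 1 - exp (- (real m * p * measure std_normal_distribution {x..})) - exp (- y\<^sup>2 / 2)"
proof -
  note One_nat_def [simp del]
  interpret N: prob_space std_normal_distribution by (rule prob_space_std_normal)
  interpret L: prob_space "latent m \<mu> p" by (rule prob_space_latent)
  define T where "T = (\<lambda>(\<theta>, z). \<lambda>i\<in>{1..m}. \<theta> i + sqrt \<rho> * z 0 + sqrt (1 - \<rho>) * z i :: real)"
  define q where "q = measure std_normal_distribution {x..}"
  define R where "R = {X \<in> space (equicorr_gauss m \<mu> p \<rho>). combined_p r m X \<le> threshold r m \<alpha>}"
  define E where "E = {w \<in> space (latent m \<mu> p). \<forall>i\<in>{1..m}. \<not> (fst w i \<ge> \<mu> \<and> snd w i \<ge> x)}"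
  define F where "F = {w \<in> space (latent m \<mu> p). snd w 0 \<in> {..-y}}"
  have q: "0 \<le> q" "q \<le> 1" unfolding q_def by auto
  have pq: "p * q \<le> 1" using mult_le_one[OF \<open>p \<le> 1\<close> q] .
  have E[measurable]: "E \<in> sets (latent m \<mu> p)"
    unfolding E_def by measurable
  have F[measurable]: "F \<in> sets (latent m \<mu> p)"
    unfolding F_def by measurable
  have T: "T \<in> latent m \<mu> p \<rightarrow>\<^sub>M (\<Pi>\<^sub>M i\<in>{1..m}. borel)"
    unfolding T_def by (rule equicorr_gauss_measurable)
  have R: "R \<in> sets (\<Pi>\<^sub>M i\<in>{1..m}. borel)"
    using rejection_event[of m \<mu> p \<rho> r \<alpha>] unfolding R_def equicorr_gauss_def by simp
  have sub: "space (latent m \<mu> p) - (E \<union> F) \<subseteq> T -` R \<inter> space (latent m \<mu> p)"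
  proof
    fix w assume w: "w \<in> space (latent m \<mu> p) - (E \<union> F)"
    then obtain j where j: "j \<in> {1..m}" "fst w j \<ge> \<mu>" "snd w j \<ge> x"
      by (auto simp: E_def)
    have z0: "snd w 0 \<ge> - y" using w by (auto simp: F_def)
    have "sqrt \<rho> * (- y) \<le> sqrt \<rho> * snd w 0"
      using assms z0 by (intro mult_left_mono) auto
    moreover have "sqrt (1 - \<rho>) * x \<le> sqrt (1 - \<rho>) * snd w j"
      using assms j by (intro mult_left_mono) auto
    ultimately have "s \<le> T w j"
      using shift j by (auto simp: T_def case_prod_beta)
    then have "p_value (T w j) \<le> p_value s"
      unfolding p_value_eq_measure by (intro N.finite_measure_mono) auto
    also have "\<dots> \<le> exp (- s\<^sup>2 / 2)"
      unfolding p_value_eq_measure by (rule std_normal_lower_tail_le) fact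
    finally have "combined_p r m (T w) \<le> threshold r m \<alpha>"
      using assms j small by (intro combined_p_le_threshold[of r \<alpha> j]) auto
    moreover have "T w \<in> space (\<Pi>\<^sub>M i\<in>{1..m}. borel)"
      using measurable_space[OF T] w by auto
    ultimately show "w \<in> T -` R \<inter> space (latent m \<mu> p)"
      using w by (auto simp: R_def equicorr_gauss_def)
  qed
  have "emeasure (latent m \<mu> p) E = ennreal ((1 - p * q) ^ m)"
    unfolding E_def q_def by (rule emeasure_no_large_signal) fact+
  then have "L.prob E = (1 - p * q) ^ m"
    using pq by (simp add: L.emeasure_eq_measure)
  also have "\<dots> \<le> exp (- (p * q)) ^ m"
    using exp_ge_add_one_self[of "- (p * q)"] pq by (intro power_mono) auto
  also have "\<dots> = exp (- (real m * p * q))"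
    by (simp add: exp_of_nat_mult[symmetric] mult.assoc)
  finally have PE: "L.prob E \<le> exp (- (real m * p * q))" .
  have PF: "L.prob F \<le> exp (- y\<^sup>2 / 2)"
    unfolding F_def by (subst prob_common_factor) (simp, rule std_normal_lower_tail_le, fact)
  have "1 - L.prob E - L.prob F \<le> 1 - L.prob (E \<union> F)"
    using measure_Un_le[OF E F] by simp
  also have "\<dots> = L.prob (space (latent m \<mu> p) - (E \<union> F))"
    by (subst L.prob_compl) auto
  also have "\<dots> \<le> L.prob (T -` R \<inter> space (latent m \<mu> p))"
    by (rule L.finite_measure_mono[OF sub]) (rule measurable_sets[OF T R])
  also have "\<dots> = measure (distr (latent m \<mu> p) (\<Pi>\<^sub>M i\<in>{1..m}. borel) T) R"
    by (rule measure_distr[OF T R, symmetric])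
  also have "\<dots> = power_of_test m \<mu> p \<rho> r \<alpha>"
    unfolding power_of_test_def R_def equicorr_gauss_def T_def ..
  finally show ?thesis
    using PE PF unfolding q_def by linarith
qed

section \<open>Asymptotics\<close>

lemma exp_at_log_scale:
  assumes "m \<ge> 1"
  shows "exp (- (s * sqrt (2 * ln (real m)))\<^sup>2 / 2) = real m powr (- s\<^sup>2)"
  using assms by (simp add: powr_def power_mult_distrib)

text \<open>The left-hand side is \<open>m powr (- s\<^sup>2)\<close>, and \<open>s\<^sup>2 > 1\<close> beats the factor \<open>m ln m\<close>.\<close>

lemma eventually_exp_le_threshold:
  fixes s \<alpha> :: real
  assumes "s > 1" "\<alpha> > 0"
  shows "eventually (\<lambda>m. exp (- (s * sqrt (2 * ln (real m)))\<^sup>2 / 2)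
      \<le> \<alpha> / (real m * (1 + \<alpha> * ln (real m)))) sequentially"
proof -
  have s2: "s\<^sup>2 > 1" using assms by (simp add: one_less_power)
  have "((\<lambda>m. (1 + \<alpha> * ln (real m)) * real m powr (1 - s\<^sup>2)) \<longlongrightarrow> 0) sequentially"
    using assms s2 by real_asymp
  then have "eventually (\<lambda>m. (1 + \<alpha> * ln (real m)) * real m powr (1 - s\<^sup>2) < \<alpha>) sequentially"
    using assms(2) by (rule order_tendstoD)
  then show ?thesis
    using eventually_ge_at_top[of 1]
  proof eventually_elim
    case (elim m)
    have pos: "1 + \<alpha> * ln (real m) > 0"
      using elim assms by (simp add: add_pos_nonneg)
    have "exp (- (s * sqrt (2 * ln (real m)))\<^sup>2 / 2) = real m powr (- s\<^sup>2)"
      using elim by (intro exp_at_log_scale) simp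
    also have "\<dots> = real m powr (1 - s\<^sup>2) / real m"
      using elim by (simp add: powr_diff powr_minus field_simps)
    also have "\<dots> \<le> \<alpha> / (1 + \<alpha> * ln (real m)) / real m"
      using elim pos by (intro divide_right_mono) (auto simp: pos_le_divide_eq mult.commute)
    also have "\<dots> = \<alpha> / (real m * (1 + \<alpha> * ln (real m)))"
      by (simp add: mult.commute)
    finally show ?case .
  qed
qed

text \<open>For signal probability \<open>\<kappa> * m powr (\<gamma> - 1)\<close> the expression bounds from below the expected
  number of signals whose noise exceeds \<open>t sqrt (2 ln m)\<close>. It is \<open>m powr (\<gamma> - t\<^sup>2)\<close> up to the exponential of a multiple
  of \<open>sqrt (ln m)\<close>.\<close>

lemma expected_large_signals_at_top:
  fixes t \<gamma> \<kappa> :: real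
  assumes "0 \<le> t" "t\<^sup>2 < \<gamma>" "\<kappa> > 0"
  shows "filterlim (\<lambda>m. real m * (\<kappa> * real m powr (\<gamma> - 1))
      * std_normal_density (t * sqrt (2 * ln (real m)) + 1)) at_top sequentially"
proof -
  define d where "d = \<gamma> - t\<^sup>2"
  have d: "d > 0" using assms by (simp add: d_def)
  have "filterlim (\<lambda>m. \<kappa> / sqrt (2 * pi)
      * exp (d * ln (real m) - t * sqrt (2 * ln (real m)) - 1 / 2)) at_top sequentially"
    using assms d by (cases "t = 0"; simp; real_asymp)
  then show ?thesis
  proof (rule filterlim_mono_eventually[OF _ order_refl order_refl])
    show "eventually (\<lambda>m. \<kappa> / sqrt (2 * pi)
        * exp (d * ln (real m) - t * sqrt (2 * ln (real m)) - 1 / 2)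
      = real m * (\<kappa> * real m powr (\<gamma> - 1))
        * std_normal_density (t * sqrt (2 * ln (real m)) + 1)) sequentially"
      using eventually_ge_at_top[of 1]
    proof eventually_elim
      case (elim m)
      have "real m * real m powr (\<gamma> - 1) = exp (\<gamma> * ln (real m))"
        using elim by (simp add: powr_mult_base) (simp add: powr_def)
      moreover have "\<gamma> * ln (real m) + - (t * sqrt (2 * ln (real m)) + 1)\<^sup>2 / 2
          = d * ln (real m) - t * sqrt (2 * ln (real m)) - 1 / 2"
        using elim by (simp add: d_def power2_sum power_mult_distrib field_simps)
      ultimately show ?case
        unfolding std_normal_density_def
        by (simp add: exp_add[symmetric] mult_ac)
    qed
  qed
qed

text \<open>More signals only help, so a lower bound on \<open>\<pi>\<close> treats the dense and the sparse regime at once;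
  \<open>\<gamma> = 1\<close> is the case of a proportion of signals bounded away from zero.\<close>

lemma power_tendsto_1:
  fixes r c \<rho> \<alpha> \<gamma> \<kappa> :: real and \<mu> \<pi> :: "nat \<Rightarrow> real"
  assumes "r \<le> -1" "c > 0" "\<alpha> > 0" "0 \<le> \<rho>" "\<rho> \<le> 1"
    and \<mu>: "\<And>m. m \<ge> 1 \<Longrightarrow> \<mu> m = sqrt (2 * c * ln (real m))"
    and \<pi>: "\<And>m. m \<ge> 1 \<Longrightarrow> 0 \<le> \<pi> m \<and> \<pi> m \<le> 1"
    and "\<kappa> > 0" "\<gamma> > 0"
    and dense: "eventually (\<lambda>m. \<kappa> * real m powr (\<gamma> - 1) \<le> \<pi> m) sequentially"
    and detect: "sqrt c > 1 - sqrt (\<gamma> * (1 - \<rho>))"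
  shows "(\<lambda>m. power_of_test m (\<mu> m) (\<pi> m) \<rho> r \<alpha>) \<longlonglongrightarrow> 1"
proof -
  interpret N: prob_space std_normal_distribution by (rule prob_space_std_normal)
  define \<delta> where "\<delta> = sqrt c + sqrt (1 - \<rho>) * sqrt \<gamma> - 1"
  have \<delta>: "\<delta> > 0"
    using detect unfolding \<delta>_def by (simp add: real_sqrt_mult mult.commute)
  \<comment> \<open>The slack \<open>\<delta>\<close> is spent as \<open>\<delta> / 2\<close> on \<open>t < sqrt \<gamma>\<close>, \<open>\<delta> / 4\<close> on the
      shared factor and \<open>\<delta> / 4\<close> on \<open>s > 1\<close>. The maximum keeps \<open>t\<close> nonnegative when \<open>\<delta>\<close> is
      large, so that \<open>t < sqrt \<gamma>\<close> can be squared.\<close>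
  define t where "t = max 0 (sqrt \<gamma> - \<delta> / 2)"
  define s where "s = 1 + \<delta> / 4"
  define e where "e = \<delta> / 4"
  have "s > 1" "e > 0" using \<delta> by (auto simp: s_def e_def)
  have t: "0 \<le> t" "t < sqrt \<gamma>" "t \<ge> sqrt \<gamma> - \<delta> / 2"
    using \<delta> \<open>\<gamma> > 0\<close> by (auto simp: t_def)
  have t2: "t\<^sup>2 < \<gamma>"
    using t real_sqrt_less_iff[of "t\<^sup>2" \<gamma>] by simp
  have "sqrt (1 - \<rho>) * (sqrt \<gamma> - \<delta> / 2) \<le> sqrt (1 - \<rho>) * t"
    using t assms by (intro mult_left_mono) auto
  moreover have "sqrt (1 - \<rho>) * (\<delta> / 2) \<le> 1 * (\<delta> / 2)"
    using assms \<delta> by (intro mult_right_mono) auto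
  moreover have "sqrt \<rho> * e \<le> 1 * e"
    using assms \<delta> by (intro mult_right_mono) (auto simp: e_def)
  ultimately have margin: "s \<le> sqrt c + sqrt (1 - \<rho>) * t - sqrt \<rho> * e"
    using \<delta>_def unfolding s_def e_def right_diff_distrib by linarith
  define l where "l m = sqrt (2 * ln (real m))" for m
  \<comment> \<open>A lower bound for the expected number \<open>m p q\<close> of signals with noise at least \<open>t l\<close>.\<close>
  define g where "g m = real m * (\<kappa> * real m powr (\<gamma> - 1)) * std_normal_density (t * l m + 1)" for m
  have lower: "eventually (\<lambda>m. 1 - exp (- g m) - exp (- (e * l m)\<^sup>2 / 2)
      \<le> power_of_test m (\<mu> m) (\<pi> m) \<rho> r \<alpha>) sequentially"
    using dense eventually_exp_le_threshold[OF \<open>s > 1\<close> \<open>\<alpha> > 0\<close>] eventually_ge_at_top[of 2]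
  proof eventually_elim
    case (elim m)
    define q where "q = measure std_normal_distribution {t * l m..}"
    have m: "ln (real m) > 0" "l m > 0" using elim by (auto simp: l_def)
    have \<mu>l: "\<mu> m = sqrt c * l m"
      using \<mu>[of m] elim by (simp add: l_def real_sqrt_mult)
    have "std_normal_density (t * l m + 1) \<le> measure std_normal_distribution {t * l m..t * l m + 1}"
      using std_normal_unit_interval_ge[of "t * l m"] t m by simp
    also have "\<dots> \<le> q"
      unfolding q_def by (rule N.finite_measure_mono) auto
    finally have "g m \<le> real m * \<pi> m * q"
      unfolding g_def using elim \<pi>[of m] by (intro mult_mono) (use \<open>\<kappa> > 0\<close> in auto)
    moreover have "s * l m \<le> (sqrt c + sqrt (1 - \<rho>) * t - sqrt \<rho> * e) * l m"
      using margin m by (intro mult_right_mono) auto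
    then have "1 - exp (- (real m * \<pi> m * q)) - exp (- (e * l m)\<^sup>2 / 2)
        \<le> power_of_test m (\<mu> m) (\<pi> m) \<rho> r \<alpha>"
      unfolding q_def using elim m assms \<pi>[of m] \<delta> \<mu>l
      by (intro power_of_test_ge[where s = "s * l m"])
        (auto simp: s_def e_def l_def[symmetric] algebra_simps)
    ultimately show ?case
      by (smt (verit) exp_le_cancel_iff)
  qed
  have limit: "(\<lambda>m. 1 - exp (- g m) - exp (- (e * l m)\<^sup>2 / 2)) \<longlonglongrightarrow> 1"
  proof -
    have "filterlim g at_top sequentially"
      unfolding g_def l_def by (rule expected_large_signals_at_top) fact+
    then have "(\<lambda>m. exp (- g m)) \<longlonglongrightarrow> 0"
      by (intro filterlim_compose[OF exp_at_bot] filterlim_uminus_at_top[THEN iffD1])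
    moreover have "(\<lambda>m. exp (- (e * l m)\<^sup>2 / 2)) \<longlonglongrightarrow> 0"
    proof (rule Lim_transform_eventually)
      show "(\<lambda>m. real m powr (- e\<^sup>2)) \<longlonglongrightarrow> 0"
        using \<open>e > 0\<close> by real_asymp
      show "eventually (\<lambda>m. real m powr (- e\<^sup>2) = exp (- (e * l m)\<^sup>2 / 2)) sequentially"
        unfolding l_def using eventually_ge_at_top[of 1]
        by eventually_elim (rule exp_at_log_scale[symmetric])
    qed
    ultimately have "(\<lambda>m. 1 - exp (- g m) - exp (- (e * l m)\<^sup>2 / 2)) \<longlonglongrightarrow> 1 - 0 - 0"
      by (intro tendsto_diff tendsto_const)
    then show ?thesis by simp
  qed
  have upper: "power_of_test m (\<mu> m) (\<pi> m) \<rho> r \<alpha> \<le> 1" for m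
    unfolding power_of_test_def by (rule prob_space.prob_le_1[OF prob_space_equicorr_gauss])
  show ?thesis
    by (rule tendsto_sandwich[OF lower _ limit tendsto_const]) (simp add: upper)
qed

theorem theorem7:
  fixes r c \<rho> \<alpha> :: real and \<mu> \<pi> :: "nat \<Rightarrow> real"
  assumes "r \<le> -1"
    and "c > 0"
    and "\<And>m. m \<ge> 1 \<Longrightarrow> \<mu> m = sqrt (2 * c * ln (real m))"
    and "\<And>m. m \<ge> 1 \<Longrightarrow> 0 \<le> \<pi> m \<and> \<pi> m \<le> 1"
    and "0 \<le> \<rho>" and "\<rho> \<le> 1"
    and "(\<exists>\<pi>\<^sub>0. \<pi> \<longlonglongrightarrow> \<pi>\<^sub>0 \<and> \<pi>\<^sub>0 > 0 \<and> sqrt c > 1 - sqrt (1 - \<rho>))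
       \<or> (\<exists>\<gamma>. 0 < \<gamma> \<and> \<gamma> < 1 \<and> (\<forall>m\<ge>1. \<pi> m = real m powr (\<gamma> - 1))
              \<and> sqrt c > 1 - sqrt (\<gamma> * (1 - \<rho>)))"
    and "\<alpha> > 0"
  shows "(\<lambda>m. power_of_test m (\<mu> m) (\<pi> m) \<rho> r \<alpha>) \<longlonglongrightarrow> 1"
  using assms(7)
proof (elim disjE exE conjE)
  fix \<pi>\<^sub>0 assume lim: "\<pi> \<longlonglongrightarrow> \<pi>\<^sub>0" "\<pi>\<^sub>0 > 0" and "sqrt c > 1 - sqrt (1 - \<rho>)"
  have "eventually (\<lambda>m. \<pi>\<^sub>0 / 2 < \<pi> m) sequentially"
    using lim by (intro order_tendstoD(1)[OF lim(1)]) simp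
  then have "eventually (\<lambda>m. \<pi>\<^sub>0 / 2 * real m powr (1 - 1) \<le> \<pi> m) sequentially"
    using eventually_ge_at_top[of 1] by eventually_elim simp
  then show ?thesis
    using assms lim \<open>sqrt c > 1 - sqrt (1 - \<rho>)\<close>
    by (intro power_tendsto_1[where \<gamma> = 1 and \<kappa> = "\<pi>\<^sub>0 / 2"]) auto
next
  fix \<gamma> :: real
  assume "0 < \<gamma>" and pw: "\<forall>m\<ge>1. \<pi> m = real m powr (\<gamma> - 1)"
    and "sqrt c > 1 - sqrt (\<gamma> * (1 - \<rho>))"
  have "eventually (\<lambda>m. 1 * real m powr (\<gamma> - 1) \<le> \<pi> m) sequentially"
    using eventually_ge_at_top[of 1] by eventually_elim (simp add: pw)
  then show ?thesis
    using assms \<open>0 < \<gamma>\<close> \<open>sqrt c > 1 - sqrt (\<gamma> * (1 - \<rho>))\<close>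
    by (intro power_tendsto_1[where \<gamma> = \<gamma> and \<kappa> = 1]) auto
qed

end
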